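(* In the two-slope ski rental problem with tail constraint $(\gamma,\delta)$ described in the context, for every $\delta\in[0,1]$ there is an optimal solution $f$ whose support is contained in $[0,L_b]\cup\{\infty\}$, where $L_b=\frac{\gamma-1}{1-a\gamma}$; i.e. $f$ puts no mass on $(L_b,\infty)$.
   Context: Fix $0\le a<1$ and $(\gamma,\delta)$ with $2-a\le\gamma<1/a$, $0\le\delta\le1$. A purchase distribution $f$ is a probability distribution on $[0,\infty)\cup\{\infty\}$ (buying time; $\infty$ = never buy). For buying time $t$ and stopping time $x>0$: $\alpha(t,x)=\frac{t+1-a+a(x-t)}{x}$ if $t\le x\le1$; $1$ if $t>x$, $x\le1$; $\frac{t+1-a+a(x-t)}{1-a+ax}$ if $t\le x$, $x>1$; $\frac{x}{1-a+ax}$ if $t>x$, $x>1$ (incl. $t=\infty$); $\alpha(t,\infty)=1$ for finite $t$, $\alpha(\infty,\infty)=1/a$. $\alpha_f(x)=\mathbb{E}_{t\sim f}\alpha(t,x)$. Bad interval $I_\gamma(x)=\{t:\alpha(t,x)>\gamma\}$; $f$ feasible if $f(I_\gamma(x))\le\delta$ for all $x\in(0,\infty]$. $\mathrm{OPT}=\min_{f\text{ feasible}}\sup_x\alpha_f(x)$; an optimal solution is a feasible $f$ attaining it. *)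

theory Defs
  imports "HOL-Probability.Probability"
begin

text \<open>
  Buying times live in \<open>[0,\<infinity>]\<close> and stopping times in \<open>(0,\<infinity>]\<close>; both are modelled by
  \<^typ>\<open>ennreal\<close>. Ratios are \<^typ>\<open>ennreal\<close>-valued because the ratio of never buying against
  an infinite stopping time, \<open>1 / a\<close>, is \<open>\<infinity>\<close> for \<open>a = 0\<close> (and \<open>1 / 0 = \<infinity>\<close> holds in
  \<^typ>\<open>ennreal\<close>). For \<open>0 \<le> a < 1\<close> every argument of \<^const>\<open>ennreal\<close> below is nonnegative,
  so nothing is truncated, and \<^const>\<open>enn2real\<close> is only relevant at finite arguments.
  For fixed \<open>x\<close> the ratio is piecewise continuous in \<open>t\<close>, hence Borel, so the expectations and
  the measures of the bad intervals below are genuine ones.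
\<close>

definition ratio :: "real \<Rightarrow> ennreal \<Rightarrow> ennreal \<Rightarrow> ennreal" where
  "ratio a t x =
    (let s = enn2real t; y = enn2real x in
     if x = \<infinity> then (if t = \<infinity> then 1 / ennreal a else 1)
     else if x \<le> 1 then
       (if t \<le> x then ennreal ((s + 1 - a + a * (y - s)) / y) else 1)
     else
       (if t \<le> x then ennreal ((s + 1 - a + a * (y - s)) / (1 - a + a * y))
        else ennreal (y / (1 - a + a * y))))"

definition purchase_distribution :: "ennreal measure \<Rightarrow> bool" where
  "purchase_distribution f \<longleftrightarrow> prob_space f \<and> sets f = sets borel"

definition expected_ratio :: "real \<Rightarrow> ennreal measure \<Rightarrow> ennreal \<Rightarrow> ennreal" where
  "expected_ratio a f x = (\<integral>\<^sup>+ t. ratio a t x \<partial>f)"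

definition worst_ratio :: "real \<Rightarrow> ennreal measure \<Rightarrow> ennreal" where
  "worst_ratio a f = (SUP x\<in>{0<..}. expected_ratio a f x)"

definition bad_interval :: "real \<Rightarrow> real \<Rightarrow> ennreal \<Rightarrow> ennreal set" where
  "bad_interval a \<gamma> x = {t. ratio a t x > ennreal \<gamma>}"

definition feasible :: "real \<Rightarrow> real \<Rightarrow> real \<Rightarrow> ennreal measure \<Rightarrow> bool" where
  "feasible a \<gamma> \<delta> f \<longleftrightarrow>
     purchase_distribution f \<and> (\<forall>x>0. measure f (bad_interval a \<gamma> x) \<le> \<delta>)"

definition OPT :: "real \<Rightarrow> real \<Rightarrow> real \<Rightarrow> ennreal" where
  "OPT a \<gamma> \<delta> = (INF f\<in>{f. feasible a \<gamma> \<delta> f}. worst_ratio a f)"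

definition optimal :: "real \<Rightarrow> real \<Rightarrow> real \<Rightarrow> ennreal measure \<Rightarrow> bool" where
  "optimal a \<gamma> \<delta> f \<longleftrightarrow> feasible a \<gamma> \<delta> f \<and> worst_ratio a f = OPT a \<gamma> \<delta>"

definition support :: "ennreal measure \<Rightarrow> ennreal set" where
  "support f = {t. \<forall>U. open U \<and> t \<in> U \<longrightarrow> emeasure f U > 0}"

definition L_b :: "real \<Rightarrow> real \<Rightarrow> real" where
  "L_b a \<gamma> = (\<gamma> - 1) / (1 - a * \<gamma>)"

end

theory Submission imports Defs begin

text \<open>
  Let \<open>F\<close> be the distribution function of the finite buying time and \<open>k = (1 - \<rho> a) / (1 - a)\<close>.
  By Fubini, the expected ratio at a stopping time \<open>x \<ge> 1\<close> is at most \<open>\<rho>\<close> iff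
  \<open>F x \<le> H x\<close> with \<open>H x = \<integral>\<^sub>0\<^sup>x F + \<rho> - k x\<close>, and the tail constraint at \<open>x\<close> reads
  \<open>F x \<le> \<delta> + F (b x)\<close>, where the bad interval starts at \<open>b x\<close>, which is at least \<open>1\<close> for \<open>x \<ge> 1\<close>.
  Both are upper bounds on \<open>F x\<close> that are monotone in \<open>F\<close>. Since \<open>H' = F - k \<le> H - k\<close> and \<open>H\<close>
  stays nonnegative, \<open>H \<ge> k\<close> on \<open>[1, \<infinity>)\<close>, so \<open>F\<close> may be raised to \<open>max F k\<close> there. Having reached
  \<open>k\<close>, the mass allowing ratio \<open>\<rho>\<close> at infinity, \<open>F\<close> can be frozen at \<open>L_b\<close>: the rest of the mass
  moves to never buying. Beyond \<open>L_b + 1\<close> never buying is bad, but the tail constraint there is only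
  \<open>F L_b \<ge> 1 - \<delta>\<close>. That the optimal value is attained follows from Helly's selection theorem.
\<close>

section \<open>The distribution function of the finite buying time and its integral\<close>

text \<open>Since \<open>enn2real \<infinity> = 0\<close>, never buying has to be excluded
  explicitly, or it would count as a purchase at time 0. Negative \<open>s\<close> give the empty
  set; they do occur, because \<open>bad_start\<close> is negative for small stopping times.\<close>

definition bought_by :: "real \<Rightarrow> ennreal set" where
  "bought_by s = {t. t \<noteq> \<infinity> \<and> enn2real t \<le> s}"

definition purchase_cdf :: "ennreal measure \<Rightarrow> real \<Rightarrow> real" where
  "purchase_cdf f s = measure f (bought_by s)"

text \<open>For a purchase distribution this is the expectation of \<open>max 0 (y - t)\<close> over
  the finite buying times \<open>t\<close>.\<close>

definition cdf_integral :: "(real \<Rightarrow> real) \<Rightarrow> real \<Rightarrow> real" where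
  "cdf_integral F y = (LINT s:{0..y}|lborel. F s)"

lemma bought_by_iff: "0 \<le> s \<Longrightarrow> t \<in> bought_by s \<longleftrightarrow> t \<le> ennreal s"
  by (cases t) (auto simp: bought_by_def top_unique)

lemma bought_by_neg: "s < 0 \<Longrightarrow> bought_by s = {}"
  by (auto simp: bought_by_def dest: order_trans[OF enn2real_nonneg])

lemma bought_by_borel [measurable]: "bought_by s \<in> sets borel"
  unfolding bought_by_def by measurable

text \<open>Makes the facts about \<open>cdf\<close> of finite Borel measures on the reals
  available. The measure can have total mass below 1, the defect being the probability of never
  buying.\<close>

lemma purchase_cdf_eq_cdf:
  assumes "purchase_distribution f"
  obtains M where "finite_borel_measure M" "purchase_cdf f = cdf M"
proof
  interpret f: prob_space f using assms by (simp add: purchase_distribution_def)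
  have sets_f[measurable_cong]: "sets f = sets borel"
    using assms by (simp add: purchase_distribution_def)
  have space_f: "space f = UNIV"
    using sets_eq_imp_space_eq[OF sets_f] by simp
  \<comment> \<open>The restriction to finite times comes first, because \<open>enn2real\<close>
    would move the atom at \<infinity> to 0.\<close>
  define M where "M = distr (density f (indicator {..<\<infinity>})) borel enn2real"
  have em: "emeasure M B = emeasure f ({..<\<infinity>} \<inter> enn2real -` B)" if "B \<in> sets borel" for B
  proof -
    have "enn2real -` B \<in> sets borel"
      using measurable_sets[OF borel_measurable_enn2real[OF measurable_ident_sets[OF refl]] that] by simp
    then show ?thesis
      using that unfolding M_def
      by (simp add: emeasure_distr emeasure_density space_f sets_f indicator_inter_arith[symmetric]
            sets.Int)
  qed
  have "space M = UNIV" "sets M = sets borel" by (simp_all add: M_def)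
  then show "finite_borel_measure M"
    by (intro finite_borel_measure.intro finite_measureI finite_borel_measure_axioms.intro)
      (simp_all add: em f.emeasure_eq_measure)
  have "{..<\<infinity>} \<inter> enn2real -` {..s} = bought_by s" for s
    by (auto simp: bought_by_def less_top)
  then show "purchase_cdf f = cdf M"
    by (auto simp: fun_eq_iff cdf_def purchase_cdf_def measure_def em)
qed

lemma
  assumes "purchase_distribution f"
  shows mono_purchase_cdf: "mono (purchase_cdf f)"
    and right_cont_purchase_cdf: "continuous (at_right x) (purchase_cdf f)"
proof -
  obtain M where "finite_borel_measure M" and *: "purchase_cdf f = cdf M"
    using purchase_cdf_eq_cdf[OF assms] .
  then interpret finite_borel_measure M by simp
  show "mono (purchase_cdf f)" "continuous (at_right x) (purchase_cdf f)"
    by (auto simp: * cdf_nondecreasing cdf_is_right_cont intro: monoI)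
qed

lemma integrable_on_Icc_mono:
  fixes F :: "real \<Rightarrow> real"
  assumes "mono F"
  shows "set_integrable lborel {x..y} F"
proof (rule set_integrable_bound)
  show "set_integrable lborel {x..y} (\<lambda>_. \<bar>F x\<bar> + \<bar>F y\<bar>)"
    by (cases "x \<le> y") (simp_all add: set_integrable_def integrable_indicator_iff)
  show "set_borel_measurable lborel {x..y} F"
    using borel_measurable_mono[OF assms] by (simp add: set_borel_measurable_def)
  show "AE s in lborel. s \<in> {x..y} \<longrightarrow> norm (F s) \<le> norm (\<bar>F x\<bar> + \<bar>F y\<bar>)"
    using monoD[OF assms] by (intro AE_I2) (fastforce simp: abs_if)
qed

lemma cdf_integral_split:
  assumes "mono F" "0 \<le> x" "x \<le> y"
  shows "cdf_integral F y = cdf_integral F x + (LINT s:{x..y}|lborel. F s)"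
proof -
  have "cdf_integral F y = cdf_integral F x + (LINT s:{x<..y}|lborel. F s)"
    unfolding cdf_integral_def using assms
    by (subst set_integral_Un[symmetric])
      (auto simp: ivl_disj_un intro: set_integrable_subset[OF integrable_on_Icc_mono[of F x y]]
        integrable_on_Icc_mono)
  moreover have "(LINT s:{x<..y}|lborel. F s) = (LINT s:{x..y}|lborel. F s)"
    unfolding set_lebesgue_integral_def
    by (intro integral_cong_AE)
       (use AE_lborel_singleton[of x] borel_measurable_mono[OF assms(1)] in
        \<open>auto simp: indicator_def elim!: eventually_mono\<close>)
  ultimately show ?thesis by simp
qed

lemma set_integral_Icc_bounds:
  fixes F :: "real \<Rightarrow> real"
  assumes "mono F" "x \<le> y"
  shows "F x * (y - x) \<le> (LINT s:{x..y}|lborel. F s)"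
    and "(LINT s:{x..y}|lborel. F s) \<le> F y * (y - x)"
proof -
  have *: "(LINT s:{x..y}|lborel. c) = c * (y - x)" for c :: real
    using assms(2) by (simp add: set_lebesgue_integral_def)
  have i: "set_integrable lborel {x..y} (\<lambda>_. c)" for c :: real
    by (cases "x \<le> y") (simp_all add: set_integrable_def integrable_indicator_iff)
  show "F x * (y - x) \<le> (LINT s:{x..y}|lborel. F s)"
    unfolding *[symmetric]
    by (intro set_integral_mono i integrable_on_Icc_mono assms) (auto intro: monoD[OF assms(1)])
  show "(LINT s:{x..y}|lborel. F s) \<le> F y * (y - x)"
    unfolding *[symmetric]
    by (intro set_integral_mono i integrable_on_Icc_mono assms) (auto intro: monoD[OF assms(1)])
qed

lemma cdf_integral_mono:
  assumes "mono F" "mono G" "\<And>s. 0 \<le> s \<Longrightarrow> s \<le> y \<Longrightarrow> F s \<le> G s"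
  shows "cdf_integral F y \<le> cdf_integral G y"
  unfolding cdf_integral_def
  by (intro set_integral_mono integrable_on_Icc_mono assms) (use assms(3) in auto)

lemma cdf_integral_nonneg:
  assumes "\<And>s. 0 \<le> F s"
  shows "0 \<le> cdf_integral F y"
  unfolding cdf_integral_def set_lebesgue_integral_def
  by (rule integral_nonneg_AE) (use assms in auto)

text \<open>Fubini, from \<^term>\<open>(y - t) = (LINT s:{t..y}|lborel. 1)\<close> for \<^term>\<open>t \<le> y\<close>.\<close>

lemma nn_integral_purchase_delay:
  assumes f: "purchase_distribution f" and y: "0 \<le> y"
  shows "(\<integral>\<^sup>+ t. ennreal (if t \<in> bought_by y then y - enn2real t else 0) \<partial>f)
    = ennreal (cdf_integral (purchase_cdf f) y)"
proof -
  interpret f: prob_space f using f by (simp add: purchase_distribution_def)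
  have [measurable_cong]: "sets f = sets borel" using f by (simp add: purchase_distribution_def)
  interpret P: pair_sigma_finite lborel f ..
  define J where "J s t = (indicator {0..y} s * indicator (bought_by s) t :: ennreal)" for s t
  have [measurable]: "case_prod J \<in> borel_measurable (lborel \<Otimes>\<^sub>M f)"
    unfolding J_def bought_by_def indicator_def by measurable
  have "ennreal (if t \<in> bought_by y then y - enn2real t else 0) = (\<integral>\<^sup>+ s. J s t \<partial>lborel)" for t
  proof -
    have "J s t = (if t \<noteq> \<infinity> then indicator {enn2real t..y} s else 0)" for s
      using order_trans[OF enn2real_nonneg[of t], of s] by (auto simp: J_def bought_by_def indicator_def)
    then show ?thesis
      by (cases "t = \<infinity>"; cases "enn2real t \<le> y") (simp_all add: bought_by_def)
  qed
  then have "(\<integral>\<^sup>+ t. ennreal (if t \<in> bought_by y then y - enn2real t else 0) \<partial>f)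
      = (\<integral>\<^sup>+ t. \<integral>\<^sup>+ s. J s t \<partial>lborel \<partial>f)"
    by simp
  also have "\<dots> = (\<integral>\<^sup>+ s. \<integral>\<^sup>+ t. J s t \<partial>f \<partial>lborel)"
    by (rule P.Fubini') simp
  also have "\<dots> = (\<integral>\<^sup>+ s. ennreal (indicator {0..y} s * purchase_cdf f s) \<partial>lborel)"
    unfolding J_def by (intro nn_integral_cong)
      (simp add: nn_integral_cmult f.emeasure_eq_measure purchase_cdf_def ennreal_mult
         ennreal_indicator)
  also have "\<dots> = ennreal (cdf_integral (purchase_cdf f) y)"
    unfolding cdf_integral_def set_lebesgue_integral_def
    using integrable_on_Icc_mono[OF mono_purchase_cdf[OF f], of 0 y]
    by (subst nn_integral_eq_integral) (auto simp: set_integrable_def purchase_cdf_def)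
  finally show ?thesis .
qed

section \<open>Limits of monotone right-continuous functions and their realisation as
  distributions\<close>

lemma right_cont_lower_bound:
  fixes F :: "real \<Rightarrow> real"
  assumes "continuous (at_right y) F" "\<And>z. y < z \<Longrightarrow> c \<le> F z"
  shows "c \<le> F y"
  using assms eventually_at_right_less[of y]
  by (intro tendsto_lowerbound[of F _ "at_right y"]) (auto simp: continuous_within elim: eventually_mono)

lemma right_cont_cong:
  fixes F G :: "real \<Rightarrow> real"
  assumes F: "continuous (at_right x) F" and "x < d" and eq: "\<And>y. x \<le> y \<Longrightarrow> y < d \<Longrightarrow> G y = F y"
  shows "continuous (at_right x) G"
proof -
  have "\<forall>\<^sub>F y in at_right x. F y = G y"
    using eventually_at_right_real[OF \<open>x < d\<close>] by eventually_elim (simp add: eq)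
  then show ?thesis
    using F eq[of x] \<open>x < d\<close> by (auto simp: continuous_within intro: Lim_transform_eventually)
qed

text \<open>Convergence in Helly's theorem is known only off the countably many jumps of the limit.
  Constraints are therefore checked at nearby points to the right that avoid the jumps; such points
  exist because open intervals are uncountable.\<close>

lemma isCont_less_right_avoiding:
  fixes g :: "real \<Rightarrow> real"
  assumes "isCont g x" "g x < c" "countable S"
  obtains y where "x < y" "y \<notin> S" "g y < c"
proof -
  have "(g \<longlongrightarrow> g x) (at_right x)"
    using assms(1) by (simp add: isCont_def filterlim_at_split)
  then have "\<forall>\<^sub>F y in at_right x. g y < c"
    using assms(2) by (rule order_tendstoD)
  then obtain d where d: "x < d" "\<And>y. x < y \<Longrightarrow> y < d \<Longrightarrow> g y < c"
    unfolding eventually_at_right_field by blast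
  have "\<not> {x<..<d} \<subseteq> S"
    using uncountable_open_interval[of x d] d(1) assms(3) countable_subset by blast
  then obtain y where "x < y" "y < d" "y \<notin> S"
    unfolding subset_iff greaterThanLessThan_iff by blast
  then show ?thesis using d(2) that by blast
qed

corollary between_avoiding:
  fixes x z :: real
  assumes "x < z" "countable S"
  obtains y where "x < y" "y \<notin> S" "y < z"
  using isCont_less_right_avoiding[OF continuous_ident assms] that by blast

text \<open>Dominated convergence: pointwise convergence can fail only at discontinuities of the
  monotone \<open>G\<close>, which form a countable, hence null, set.\<close>

lemma cdf_integral_tendsto:
  assumes mono: "\<And>n. mono (F n)" and bd: "\<And>n s. \<bar>F n s\<bar> \<le> 1" and "mono G"
    and lim: "\<And>s. isCont G s \<Longrightarrow> (\<lambda>n. F n s) \<longlonglongrightarrow> G s"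
  shows "(\<lambda>n. cdf_integral (F n) y) \<longlonglongrightarrow> cdf_integral G y"
  unfolding cdf_integral_def set_lebesgue_integral_def
proof (rule integral_dominated_convergence)
  show "integrable lborel (\<lambda>s. indicator {0..y} s :: real)"
    by (cases "0 \<le> y") (simp_all add: integrable_indicator_iff)
  have "AE s in lborel. isCont G s"
    by (rule AE_I'[OF countable_imp_null_set_lborel[OF mono_ctble_discont[OF \<open>mono G\<close>]]]) auto
  then show "AE s in lborel. (\<lambda>n. indicator {0..y} s *\<^sub>R F n s) \<longlonglongrightarrow> indicator {0..y} s *\<^sub>R G s"
    by eventually_elim (intro tendsto_intros lim)
  show "AE s in lborel. norm (indicator {0..y} s *\<^sub>R F n s) \<le> indicator {0..y} s" for n
    using bd by (simp add: indicator_def)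
qed (use borel_measurable_mono[OF mono] borel_measurable_mono[OF \<open>mono G\<close>] in measurable)

lemma purchase_distribution_of_cdf:
  assumes mono: "mono G" and rc: "\<And>x. continuous (at_right x) G"
    and zero: "\<And>x. x < 0 \<Longrightarrow> G x = 0" and le_1: "\<And>x. G x \<le> 1"
    and const: "\<And>x. c \<le> x \<Longrightarrow> G x = G c" and c: "0 \<le> c"
  obtains f where "purchase_distribution f" "purchase_cdf f = G" "emeasure f {ennreal c<..<\<infinity>} = 0"
proof
  text \<open>The mass \<^term>\<open>1 - G c\<close> of never buying is parked at the real \<^term>\<open>c + 1\<close>.\<close>
  define M where "M x = (if x < c + 1 then G x else 1)" for x
  define g where "g s = (if s \<le> c then ennreal s else \<infinity>)" for s
  have M_mono: "M x \<le> M y" if "x \<le> y" for x y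
    using that monoD[OF mono] le_1 by (auto simp: M_def)
  have M_rc: "continuous (at_right x) M" for x
  proof (cases "x < c + 1")
    case True
    then show ?thesis by (rule right_cont_cong[OF rc]) (simp add: M_def)
  next
    case False
    show ?thesis
      by (rule right_cont_cong[of x "\<lambda>_. 1" "x + 1"]) (use False in \<open>auto simp: M_def\<close>)
  qed
  have "\<forall>\<^sub>F x in at_bot. M x = 0"
    using eventually_le_at_bot[of "- 1"] by eventually_elim (use c in \<open>simp add: M_def zero\<close>)
  then have "(M \<longlongrightarrow> 0) at_bot" by (rule tendsto_eventually)
  moreover have "\<forall>\<^sub>F x in at_top. M x = 1"
    using eventually_ge_at_top[of "c + 1"] by eventually_elim (simp add: M_def)
  then have "(M \<longlongrightarrow> 1) at_top" by (rule tendsto_eventually)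
  ultimately have dist: "real_distribution (interval_measure M)" and cdf_M: "cdf (interval_measure M) = M"
    using M_mono M_rc by (auto intro: real_distribution_interval_measure cdf_interval_measure)
  interpret real_distribution "interval_measure M" by (rule dist)
  have [measurable]: "g \<in> borel_measurable (interval_measure M)"
    unfolding g_def by measurable
  define f where "f = distr (interval_measure M) borel g"
  show "purchase_distribution f"
    unfolding purchase_distribution_def f_def by (simp add: prob_space_distr)
  have "purchase_cdf f u = G u" for u
  proof (cases "u < 0")
    case True
    then show ?thesis by (simp add: purchase_cdf_def bought_by_neg zero)
  next
    case False
    \<comment> \<open>Negative reals go to 0 and reals beyond \<open>c\<close> go to \<infinity>,
      hence the cut at \<open>min u c\<close>.\<close>
    then have "g -` bought_by u = {..min u c}"
      by (auto simp: g_def bought_by_iff top_unique split: if_splits)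
    then have "purchase_cdf f u = cdf (interval_measure M) (min u c)"
      by (simp add: purchase_cdf_def f_def measure_distr cdf_def)
    also have "\<dots> = G u"
      using const[of u] by (simp add: cdf_M M_def min_def)
    finally show ?thesis .
  qed
  then show "purchase_cdf f = G" by (rule ext)
  have "g -` {ennreal c<..<\<infinity>} = {}"
    using c by (auto simp: g_def ennreal_less_iff not_less split: if_splits)
  then show "emeasure f {ennreal c<..<\<infinity>} = 0"
    by (simp add: f_def emeasure_distr)
qed

section \<open>Offline cost and the shape of the bad intervals\<close>

locale ski_rental =
  fixes a \<gamma> \<delta> :: real
  assumes a_nonneg: "0 \<le> a" and a_less_1: "a < 1"
    and gamma_ge: "2 - a \<le> \<gamma>" and a_gamma: "a * \<gamma> < 1"
    and delta_nonneg: "0 \<le> \<delta>"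
begin

text \<open>The offline optimum, either renting throughout or buying at time 0. The two costs agree
  at \<open>y = 1\<close>, so this is the denominator of \<open>ratio\<close> on both sides of
  1.\<close>

definition opt_cost :: "real \<Rightarrow> real" where
  "opt_cost y = min y (1 - a + a * y)"

text \<open>The solution \<open>t\<close> of
  \<open>t + 1 - a + a * (y - t) = \<gamma> * opt_cost y\<close>, the buying time whose cost is
  exactly \<gamma> times the optimum.\<close>

definition bad_start :: "real \<Rightarrow> real" where
  "bad_start y = (\<gamma> * opt_cost y - a * y) / (1 - a) - 1"

abbreviation L where "L \<equiv> L_b a \<gamma>"

lemma gamma_gt_1: "1 < \<gamma>" and gamma_pos: "0 < \<gamma>" and a_less_gamma: "a < \<gamma>"
  using gamma_ge a_less_1 by auto

lemma opt_cost_le_1: "y \<le> 1 \<Longrightarrow> opt_cost y = y"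
  using a_less_1 mult_left_mono[of y 1 "1 - a"] by (auto simp: opt_cost_def algebra_simps)

lemma opt_cost_ge_1: "1 \<le> y \<Longrightarrow> opt_cost y = 1 - a + a * y"
  using a_less_1 mult_left_mono[of 1 y "1 - a"] by (auto simp: opt_cost_def algebra_simps)

lemma opt_cost_pos: "0 < y \<Longrightarrow> 0 < opt_cost y"
  using a_nonneg a_less_1 by (auto simp: opt_cost_def intro: add_pos_nonneg)

text \<open>The claim amounts to \<open>2 \<le> \<gamma> * (1 + a)\<close>, and (2 - a)(1 + a) = 2 +
  a(1 - a). It puts the truncation point where \<open>opt_cost\<close> is the cost of
  buying.\<close>

lemma L_ge_1: "1 \<le> L"
proof -
  have "(2 - a) * (1 + a) \<le> \<gamma> * (1 + a)"
    using gamma_ge a_nonneg by (intro mult_right_mono) auto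
  moreover have "(1 - a) * a \<ge> 0" using a_nonneg a_less_1 by simp
  ultimately have "2 \<le> \<gamma> * (1 + a)" by (simp add: algebra_simps)
  then show ?thesis using a_gamma by (simp add: L_b_def field_simps)
qed

lemma bad_start_eq: "1 \<le> y \<Longrightarrow> bad_start y = \<gamma> - 1 + a * (\<gamma> - 1) / (1 - a) * y"
  using a_less_1 by (simp add: bad_start_def opt_cost_ge_1 field_simps)

text \<open>The numerator is the minimum of two affine functions with slopes
  \<open>\<gamma> - a\<close> and \<open>a * (\<gamma> - 1)\<close>, both nonnegative.\<close>

lemma bad_start_mono: "x \<le> y \<Longrightarrow> bad_start x \<le> bad_start y"
proof -
  assume "x \<le> y"
  have "(\<gamma> - a) * x \<le> (\<gamma> - a) * y" "a * (\<gamma> - 1) * x \<le> a * (\<gamma> - 1) * y"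
    using a_less_gamma a_nonneg gamma_gt_1 \<open>x \<le> y\<close> by (auto intro!: mult_left_mono)
  moreover have "\<gamma> * opt_cost z - a * z = min ((\<gamma> - a) * z) (\<gamma> * (1 - a) + a * (\<gamma> - 1) * z)" for z
    using mult_le_cancel_left_pos[OF gamma_pos, of z "1 - a + a * z"]
    by (auto simp: opt_cost_def min_def algebra_simps)
  ultimately have "\<gamma> * opt_cost x - a * x \<le> \<gamma> * opt_cost y - a * y"
    by (auto simp: min_def)
  then show ?thesis
    using a_less_1 by (simp add: bad_start_def divide_right_mono)
qed

lemma isCont_bad_start: "isCont bad_start y"
  unfolding bad_start_def[abs_def] opt_cost_def using a_less_1 by (intro continuous_intros) auto

text \<open>By monotonicity it is enough to look at 1, where the value is
  \<open>(\<gamma> - 1) / (1 - a)\<close>. Consequently, raising \<open>F\<close> on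
  \<open>[1, \<infinity>)\<close> also raises the right side of the tail condition at every
  \<open>x \<ge> 1\<close>.\<close>

lemma bad_start_ge_1: "1 \<le> y \<Longrightarrow> 1 \<le> bad_start y"
proof -
  have "\<gamma> - 1 + a * (\<gamma> - 1) / (1 - a) * 1 = (\<gamma> - 1) / (1 - a)"
    using a_less_1 by (simp add: field_simps)
  then have "1 \<le> bad_start 1"
    using a_less_1 gamma_ge by (simp add: bad_start_eq)
  moreover assume "1 \<le> y"
  ultimately show ?thesis using bad_start_mono[of 1 y] by simp
qed

text \<open>\<^term>\<open>L + 1\<close> is the stopping time beyond which never buying is bad, and \<^term>\<open>L\<close> is where
  the bad interval starts there.\<close>

lemma bad_start_L: "bad_start (L + 1) = L"
proof -
  have *: "L + 1 = \<gamma> * (1 - a) / (1 - a * \<gamma>)"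
    using a_gamma by (simp add: L_b_def field_simps)
  have "bad_start (L + 1) = \<gamma> - 1 + a * (\<gamma> - 1) / (1 - a) * (L + 1)"
    using L_ge_1 by (simp add: bad_start_eq)
  also have "a * (\<gamma> - 1) / (1 - a) * (L + 1) = a * (\<gamma> - 1) * \<gamma> / (1 - a * \<gamma>)"
    unfolding * using a_less_1 by simp
  also have "\<gamma> - 1 + \<dots> = L"
    using a_gamma by (simp add: L_b_def field_simps)
  finally show ?thesis .
qed

lemma rent_ratio_le_iff:
  assumes "0 < y"
  shows "y / opt_cost y \<le> \<gamma> \<longleftrightarrow> y \<le> L + 1"
proof (cases "y \<le> 1")
  case True
  then show ?thesis using assms gamma_gt_1 L_ge_1 by (simp add: opt_cost_le_1)
next
  case False
  have "y / opt_cost y \<le> \<gamma> \<longleftrightarrow> y \<le> \<gamma> * opt_cost y"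
    using opt_cost_pos[OF assms] by (simp add: field_simps)
  also have "\<dots> \<longleftrightarrow> y * (1 - a * \<gamma>) \<le> \<gamma> * (1 - a)"
    using False by (simp add: opt_cost_ge_1 algebra_simps)
  also have "\<dots> \<longleftrightarrow> y \<le> \<gamma> * (1 - a) / (1 - a * \<gamma>)"
    using a_gamma by (simp add: field_simps)
  also have "\<gamma> * (1 - a) / (1 - a * \<gamma>) = L + 1"
    using a_gamma by (simp add: L_b_def field_simps)
  finally show ?thesis .
qed

text \<open>The cost is split into pure renting, \<open>y\<close>, and the extra cost
  \<open>(1 - a) * (t + 1 - y)\<close> of having bought by then. This isolates the delay
  \<open>y - t\<close>, whose expectation is \<open>cdf_integral\<close>.\<close>

definition real_ratio :: "ennreal \<Rightarrow> real \<Rightarrow> real" where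
  "real_ratio t y =
     (y + (if t \<in> bought_by y then (1 - a) * (enn2real t + 1 - y) else 0)) / opt_cost y"

lemma ratio_eq:
  assumes "0 < y"
  shows "ratio a t (ennreal y) = ennreal (real_ratio t y)"
proof (cases "y \<le> 1")
  case True
  then show ?thesis
    using assms bought_by_iff[of y t]
    by (auto simp: ratio_def real_ratio_def Let_def opt_cost_le_1 algebra_simps)
next
  case False
  then show ?thesis
    using assms bought_by_iff[of y t] opt_cost_ge_1[of y]
    by (simp add: ratio_def real_ratio_def Let_def) (simp add: algebra_simps)
qed

lemma real_ratio_nonneg: "0 < y \<Longrightarrow> 0 \<le> real_ratio t y"
proof -
  assume y: "0 < y"
  have "0 \<le> (1 - a) * (enn2real t + 1) + a * y"
    using y a_nonneg a_less_1 by simp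
  then have "0 \<le> y + (1 - a) * (enn2real t + 1 - y)"
    by (simp add: algebra_simps)
  then show ?thesis
    using y opt_cost_pos[OF y] by (simp add: real_ratio_def)
qed

lemma bad_interval_real:
  assumes "0 < y"
  shows "bad_interval a \<gamma> (ennreal y) = {t. \<gamma> < real_ratio t y}"
  using gamma_pos real_ratio_nonneg[OF assms]
  by (simp add: bad_interval_def ratio_eq[OF assms] ennreal_less_iff)

lemma bad_iff_bought:
  assumes y: "0 < y" and t: "t \<in> bought_by y"
  shows "\<gamma> < real_ratio t y \<longleftrightarrow> t \<notin> bought_by (bad_start y)"
proof -
  have "\<gamma> < real_ratio t y \<longleftrightarrow> \<gamma> * opt_cost y < y + (1 - a) * (enn2real t + 1 - y)"
    using opt_cost_pos[OF y] t by (simp add: real_ratio_def field_simps)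
  also have "\<dots> \<longleftrightarrow> (\<gamma> * opt_cost y - a * y) - (1 - a) < (1 - a) * enn2real t"
    by (simp add: algebra_simps)
  also have "\<dots> \<longleftrightarrow> bad_start y < enn2real t"
    unfolding bad_start_def using a_less_1 by (simp add: field_simps)
  finally show ?thesis using t by (auto simp: bought_by_def)
qed

text \<open>Not having bought yet is acceptable up to \<open>L + 1\<close>, so only purchases made
  too late are bad. The difference is empty if \<open>bad_start y\<close> is at least
  \<open>y\<close>.\<close>

lemma bad_interval_upto:
  assumes y: "0 < y" "y \<le> L + 1"
  shows "bad_interval a \<gamma> (ennreal y) = bought_by y - bought_by (bad_start y)"
  using bad_iff_bought[OF y(1)] rent_ratio_le_iff[OF y(1)] y(2)
  by (auto simp: bad_interval_real[OF y(1)] real_ratio_def not_less)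

lemma bad_interval_beyond:
  assumes y: "L + 1 < y"
  shows "bad_interval a \<gamma> (ennreal y) = - (bought_by y \<inter> bought_by (bad_start y))"
proof -
  have y0: "0 < y" using y L_ge_1 by simp
  show ?thesis
    using bad_iff_bought[OF y0] rent_ratio_le_iff[OF y0] y
    by (auto simp: bad_interval_real[OF y0] real_ratio_def not_less)
qed

section \<open>Ratio and tail constraints as conditions on the distribution function\<close>

lemma ratio_measurable: "(\<lambda>t. ratio a t x) \<in> borel_measurable borel"
  unfolding ratio_def Let_def by measurable

text \<open>With \<open>D = opt_cost y\<close> and \<open>c = (1 - a) / D\<close>, the ratio is
  \<open>y / D\<close> plus, for \<open>t \<le> y\<close>, the term
  \<open>c * (1 - (y - t))\<close>. In expectation the 1 contributes \<open>purchase_cdf f y\<close>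
  and the delay contributes \<open>cdf_integral\<close>.\<close>

lemma expected_ratio_le_iff:
  assumes f: "purchase_distribution f" and y: "0 < y" and "0 \<le> \<rho>"
  shows "expected_ratio a f (ennreal y) \<le> ennreal \<rho> \<longleftrightarrow>
    purchase_cdf f y \<le> cdf_integral (purchase_cdf f) y + (\<rho> * opt_cost y - y) / (1 - a)"
proof -
  interpret f: prob_space f using f by (simp add: purchase_distribution_def)
  have sets_f[measurable_cong]: "sets f = sets borel" using f by (simp add: purchase_distribution_def)
  define D where "D = opt_cost y"
  have D: "0 < D" using opt_cost_pos[OF y] by (simp add: D_def)
  define c where "c = (1 - a) / D"
  have c: "0 < c" using D a_less_1 by (simp add: c_def)
  define I where "I = cdf_integral (purchase_cdf f) y"
  have I: "0 \<le> I" unfolding I_def by (intro cdf_integral_nonneg) (simp add: purchase_cdf_def)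
  have m[measurable]: "(\<lambda>t. ratio a t (ennreal y)) \<in> borel_measurable f"
    using ratio_measurable[of "ennreal y"] measurable_cong_sets[OF sets_f refl] by blast
  have [measurable]: "(\<lambda>t. ennreal (if t \<in> bought_by y then y - enn2real t else 0)) \<in> borel_measurable f"
    unfolding bought_by_def by measurable
  have [measurable]: "bought_by y \<in> sets f" by (simp add: sets_f)
  \<comment> \<open>The delay enters with a negative sign, so it is added on the left to stay within
    \<open>ennreal\<close>.\<close>
  have "expected_ratio a f (ennreal y) + ennreal (c * I)
    = (\<integral>\<^sup>+ t. ratio a t (ennreal y) + ennreal c * ennreal (if t \<in> bought_by y then y - enn2real t else 0) \<partial>f)"
    unfolding expected_ratio_def
    using c I nn_integral_purchase_delay[OF f, of y] y
    by (subst nn_integral_add) (auto simp: nn_integral_cmult I_def ennreal_mult)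
  also have "\<dots> = (\<integral>\<^sup>+ t. ennreal (y / D) + ennreal c * indicator (bought_by y) t \<partial>f)"
  proof (rule nn_integral_cong)
    fix t
    have "real_ratio t y + c * (if t \<in> bought_by y then y - enn2real t else 0)
       = y / D + c * (if t \<in> bought_by y then 1 else 0)"
      using D unfolding real_ratio_def c_def D_def[symmetric] by (auto simp: field_simps)
    moreover have "(if t \<in> bought_by y then y - enn2real t else 0) \<ge> 0"
      by (auto simp: bought_by_def)
    ultimately show "ratio a t (ennreal y) + ennreal c * ennreal (if t \<in> bought_by y then y - enn2real t else 0)
      = ennreal (y / D) + ennreal c * indicator (bought_by y) t"
      using real_ratio_nonneg[OF y, of t] c D y
      by (auto simp: ratio_eq[OF y] ennreal_mult[symmetric] ennreal_plus[symmetric] simp del: ennreal_plus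
          split: if_splits)
  qed
  also have "\<dots> = ennreal (y / D + c * purchase_cdf f y)"
    using c D y by (subst nn_integral_add)
      (auto simp: nn_integral_cmult f.prob_space f.emeasure_eq_measure purchase_cdf_def ennreal_mult)
  finally have eq: "expected_ratio a f (ennreal y) + ennreal (c * I) = ennreal (y / D + c * purchase_cdf f y)" .
  have "expected_ratio a f (ennreal y) \<le> ennreal \<rho> \<longleftrightarrow>
      ennreal (y / D + c * purchase_cdf f y) \<le> ennreal (\<rho> + c * I)"
    unfolding eq[symmetric] using \<open>0 \<le> \<rho>\<close> c I by simp
  also have "\<dots> \<longleftrightarrow> y / D + c * purchase_cdf f y \<le> \<rho> + c * I"
    using \<open>0 \<le> \<rho>\<close> c I by (intro ennreal_le_iff) simp
  also have "\<dots> \<longleftrightarrow> D * (y / D + c * purchase_cdf f y) \<le> D * (\<rho> + c * I)"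
    using D by simp
  also have "D * (y / D + c * purchase_cdf f y) = y + (1 - a) * purchase_cdf f y"
    using D by (simp add: c_def field_simps)
  also have "D * (\<rho> + c * I) = \<rho> * D + (1 - a) * I"
    using D by (simp add: c_def field_simps)
  also have "y + (1 - a) * purchase_cdf f y \<le> \<rho> * D + (1 - a) * I \<longleftrightarrow>
      (1 - a) * purchase_cdf f y \<le> (1 - a) * (I + (\<rho> * D - y) / (1 - a))"
    using a_less_1 by (simp add: distrib_left) linarith
  also have "\<dots> \<longleftrightarrow> purchase_cdf f y \<le> I + (\<rho> * D - y) / (1 - a)"
    using a_less_1 by simp
  finally show ?thesis by (simp add: I_def D_def)
qed

text \<open>The conditions on a distribution function \<^term>\<open>F\<close> (as a function of finite buying times,
  extended by \<open>0\<close>) that express feasibility and worst ratio at most \<^term>\<open>\<rho>\<close>. The first tail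
  condition is void for stopping times beyond \<^term>\<open>L + 1\<close>; those, for which never buying is bad,
  are all covered by the condition at \<^term>\<open>L\<close>.\<close>

definition admissible :: "real \<Rightarrow> (real \<Rightarrow> real) \<Rightarrow> bool" where
  "admissible \<rho> F \<longleftrightarrow>
     mono F \<and> (\<forall>x. continuous (at_right x) F) \<and> (\<forall>x<0. F x = 0) \<and> (\<forall>x. F x \<le> 1) \<and>
     (\<forall>x>0. F x \<le> \<delta> + F (bad_start x)) \<and> 1 - \<delta> \<le> F L \<and>
     (\<forall>x>0. F x \<le> cdf_integral F x + (\<rho> * opt_cost x - x) / (1 - a))"

lemma admissibleD:
  assumes "admissible \<rho> F"
  shows "mono F" "continuous (at_right x) F" "x < 0 \<Longrightarrow> F x = 0" "F x \<le> 1"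
    "0 < x \<Longrightarrow> F x \<le> \<delta> + F (bad_start x)" "1 - \<delta> \<le> F L"
    "0 < x \<Longrightarrow> F x \<le> cdf_integral F x + (\<rho> * opt_cost x - x) / (1 - a)"
  using assms by (simp_all add: admissible_def)

lemma admissible_nonneg:
  assumes "admissible \<rho> F"
  shows "0 \<le> F x"
  using monoD[OF admissibleD(1)[OF assms], of "min x 0 - 1" x] admissibleD(3)[OF assms, of "min x 0 - 1"]
  by simp

lemma feasible_imp_admissible:
  assumes f: "feasible a \<gamma> \<delta> f" and worst: "worst_ratio a f \<le> ennreal \<rho>" and "0 \<le> \<rho>"
  shows "admissible \<rho> (purchase_cdf f)"
proof -
  let ?F = "purchase_cdf f"
  have dist: "purchase_distribution f" using f by (simp add: feasible_def)
  interpret f: prob_space f using dist by (simp add: purchase_distribution_def)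
  have sets_f: "sets f = sets borel" using dist by (simp add: purchase_distribution_def)
  have space_f: "space f = UNIV" using sets_eq_imp_space_eq[OF sets_f] by simp
  have [simp]: "bought_by s \<in> f.events" for s by (simp add: sets_f)
  have tail: "measure f (bad_interval a \<gamma> (ennreal x)) \<le> \<delta>" if "0 < x" for x
    using f that by (simp add: feasible_def)
  have mono: "mono ?F" by (rule mono_purchase_cdf[OF dist])
  have le_1: "?F x \<le> 1" for x by (simp add: purchase_cdf_def)
  have beyond: "1 - \<delta> \<le> ?F (bad_start x)" if "L + 1 < x" for x
  proof -
    have "1 - ?F (bad_start x) = measure f (- bought_by (bad_start x))"
      using f.prob_compl[of "bought_by (bad_start x)"] by (simp add: purchase_cdf_def space_f Compl_eq_Diff_UNIV)
    also have "\<dots> \<le> measure f (bad_interval a \<gamma> (ennreal x))"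
      unfolding bad_interval_beyond[OF that]
      by (rule f.finite_measure_mono) (auto simp: sets_f)
    finally show ?thesis using tail[of x] that L_ge_1 by simp
  qed
  \<comment> \<open>The constraint is available only for stopping times strictly beyond
    \<open>L + 1\<close>. Letting them decrease to \<open>L + 1\<close> sends
    \<open>bad_start\<close> to \<open>L\<close>, and right continuity of the distribution function
    gives the value there.\<close>
  have L: "1 - \<delta> \<le> ?F L"
  proof (rule right_cont_lower_bound[OF right_cont_purchase_cdf[OF dist]])
    fix z assume "L < z"
    then obtain x where "L + 1 < x" "bad_start x < z"
      using isCont_less_right_avoiding[OF isCont_bad_start, of "L + 1" z "{}"] by (auto simp: bad_start_L)
    then show "1 - \<delta> \<le> ?F z"
      using beyond[of x] monoD[OF mono, of "bad_start x" z] by simp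
  qed
  have "?F x \<le> \<delta> + ?F (bad_start x)" if "0 < x" for x
  proof (cases "x \<le> L + 1")
    case True
    have "?F x \<le> measure f ((bought_by x - bought_by (bad_start x)) \<union> bought_by (bad_start x))"
      unfolding purchase_cdf_def by (rule f.finite_measure_mono) (auto simp: sets_f)
    also have "\<dots> \<le> measure f (bought_by x - bought_by (bad_start x)) + ?F (bad_start x)"
      unfolding purchase_cdf_def by (rule measure_Un_le) (auto simp: sets_f)
    finally show ?thesis
      using tail[OF that] by (simp add: bad_interval_upto[OF that True])
  next
    case False
    then show ?thesis using beyond[of x] le_1[of x] by simp
  qed
  moreover have "?F x \<le> cdf_integral ?F x + (\<rho> * opt_cost x - x) / (1 - a)" if "0 < x" for x
  proof -
    have "expected_ratio a f (ennreal x) \<le> worst_ratio a f"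
      unfolding worst_ratio_def by (rule SUP_upper) (use that in simp)
    then show ?thesis
      using worst expected_ratio_le_iff[OF dist that \<open>0 \<le> \<rho>\<close>] by auto
  qed
  ultimately show ?thesis
    unfolding admissible_def
    using mono right_cont_purchase_cdf[OF dist] le_1 L
    by (auto simp: purchase_cdf_def bought_by_neg)
qed

section \<open>Compactness of the admissible distribution functions\<close>

lemma isCont_opt_cost: "isCont opt_cost y"
  unfolding opt_cost_def[abs_def] by (intro continuous_intros)

text \<open>Helly's selection theorem yields \<open>G\<close>. Mass escaping to the right does no
  harm, as it turns into never buying. The conditions pass to the limit at continuity points and
  extend from there.\<close>

lemma admissible_limit:
  assumes F: "\<And>n. admissible (\<rho> n) (F n)" and \<rho>: "\<rho> \<longlonglongrightarrow> r"
  obtains G where "admissible r G"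
proof -
  have bd: "\<bar>F n x\<bar> \<le> 1" for n x
    using admissible_nonneg[OF F] admissibleD(4)[OF F] by simp
  obtain s G where s: "strict_mono s" and rc: "\<And>x. continuous (at_right x) G" and mono: "mono G"
    and lim: "\<And>x. isCont G x \<Longrightarrow> (\<lambda>n. F (s n) x) \<longlonglongrightarrow> G x"
    using Helly_selection[of F 1, OF admissibleD(2)[OF F] admissibleD(1)[OF F] bd] by blast
  define S where "S = {x. \<not> isCont G x}"
  have S: "countable S" unfolding S_def by (rule mono_ctble_discont[OF mono])
  have lim: "(\<lambda>n. F (s n) x) \<longlonglongrightarrow> G x" if "x \<notin> S" for x
    using lim that by (simp add: S_def)
  \<comment> \<open>Upper bounds come from points to the right by monotonicity of \<open>G\<close>;
    lower bounds are treated by \<open>right_cont_lower_bound\<close>.\<close>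
  have bound: "G x \<le> c"
    if cont: "isCont g x" and le: "\<And>y. x < y \<Longrightarrow> y \<notin> S \<Longrightarrow> G y \<le> g y" and "g x \<le> c" for g x c
  proof (rule field_le_epsilon)
    fix e :: real assume "0 < e"
    then obtain y where "x < y" "y \<notin> S" "g y < c + e"
      using isCont_less_right_avoiding[OF cont _ S, of "c + e"] \<open>g x \<le> c\<close> by auto
    then show "G x \<le> c + e"
      using le[of y] monoD[OF mono, of x y] by simp
  qed
  have upper: "G y \<le> 1" for y
    by (rule bound[where g = "\<lambda>_. 1"]) (auto intro: LIMSEQ_le_const2[OF lim] admissibleD(4)[OF F])
  have ge_L: "1 - \<delta> \<le> G L"
  proof (rule right_cont_lower_bound[OF rc])
    fix z assume "L < z"
    then obtain y where y: "L < y" "y \<notin> S" "y < z"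
      using between_avoiding[OF _ S] by metis
    have "1 - \<delta> \<le> F n y" for n
      using admissibleD(6)[OF F] monoD[OF admissibleD(1)[OF F], of L y] y(1) by (meson less_imp_le order_trans)
    then have "1 - \<delta> \<le> G y" using LIMSEQ_le_const[OF lim[OF y(2)]] by blast
    then show "1 - \<delta> \<le> G z" using monoD[OF mono, of y z] y(3) by simp
  qed
  have zero: "G x = 0" if neg: "x < 0" for x
  proof -
    obtain y where y: "x < y" "y \<notin> S" "y < 0"
      using between_avoiding[OF neg S] .
    have "G y = 0"
      using lim[OF y(2)] admissibleD(3)[OF F y(3)] by (simp add: LIMSEQ_const_iff)
    obtain z where z: "x - 1 < z" "z \<notin> S" "z < x"
      using between_avoiding[OF _ S, of "x - 1" x] by auto
    have "G z = 0"
      using lim[OF z(2)] admissibleD(3)[OF F, of z] z(3) neg by (simp add: LIMSEQ_const_iff)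
    show ?thesis
      using \<open>G y = 0\<close> \<open>G z = 0\<close> monoD[OF mono, of z x] monoD[OF mono, of x y] y z by simp
  qed
  have tail: "G x \<le> \<delta> + G (bad_start x)" if x: "0 < x" for x
  proof -
    have "G x - \<delta> \<le> G (bad_start x)"
    proof (rule right_cont_lower_bound[OF rc])
      fix z assume "bad_start x < z"
      \<comment> \<open>\<open>G\<close> may jump at \<open>bad_start x\<close>, so that point is
        replaced by \<open>w\<close> slightly to its right; \<open>y\<close> is then taken so close
        to \<open>x\<close> that its bad interval still starts before \<open>w\<close>.\<close>
      then obtain w where w: "bad_start x < w" "w \<notin> S" "w < z"
        using between_avoiding[OF _ S] by metis
      obtain y where y: "x < y" "y \<notin> S" "bad_start y < w"
        using isCont_less_right_avoiding[OF isCont_bad_start w(1) S] .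
      have "F (s n) y \<le> \<delta> + F (s n) w" for n
        using admissibleD(5)[OF F, of y "s n"] monoD[OF admissibleD(1)[OF F], of "bad_start y" w "s n"] x y
        by simp
      then have "G y \<le> \<delta> + G w"
        by (intro LIMSEQ_le[OF lim[OF y(2)] tendsto_add[OF tendsto_const lim[OF w(2)]]]) simp
      then show "G x - \<delta> \<le> G z"
        using monoD[OF mono, of x y] monoD[OF mono, of w z] y w by simp
    qed
    then show ?thesis by simp
  qed
  have "G x \<le> cdf_integral G x + (r * opt_cost x - x) / (1 - a)" if x: "0 < x" for x
  proof (rule bound)
    \<comment> \<open>A continuous majorant in \<open>y\<close>: as \<open>G \<le> 1\<close>, the
      integral grows by at most \<open>y - x\<close>.\<close>
    let ?g = "\<lambda>y. cdf_integral G x + (y - x) + (r * opt_cost y - y) / (1 - a)"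
    show "isCont ?g x"
      using a_less_1 by (intro continuous_intros isCont_opt_cost) simp
    show "?g x \<le> cdf_integral G x + (r * opt_cost x - x) / (1 - a)" by simp
    fix y assume y: "x < y" "y \<notin> S"
    have "(\<lambda>n. cdf_integral (F (s n)) y + (\<rho> (s n) * opt_cost y - y) / (1 - a)) \<longlonglongrightarrow>
       cdf_integral G y + (r * opt_cost y - y) / (1 - a)"
      using a_less_1 lim LIMSEQ_subseq_LIMSEQ[OF \<rho> s]
      by (intro tendsto_intros cdf_integral_tendsto admissibleD(1)[OF F] bd mono)
        (auto simp: S_def o_def)
    then have "G y \<le> cdf_integral G y + (r * opt_cost y - y) / (1 - a)"
      by (rule LIMSEQ_le[OF lim[OF y(2)]]) (use x y in \<open>auto intro!: exI[of _ 0] admissibleD(7)[OF F]\<close>)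
    moreover have "cdf_integral G y \<le> cdf_integral G x + G y * (y - x)"
      using cdf_integral_split[OF mono, of x y] set_integral_Icc_bounds(2)[OF mono, of x y] x y by simp
    moreover have "G y * (y - x) \<le> y - x"
      using mult_right_mono[OF upper, of "y - x" y] y by simp
    ultimately show "G y \<le> ?g y" by simp
  qed
  then have "admissible r G"
    using mono rc zero upper tail ge_L by (simp add: admissible_def)
  then show ?thesis by (rule that)
qed

section \<open>Raising the distribution function and freezing it at \<open>L\<close>\<close>

text \<open>The least probability of ever buying for which the ratio at stopping time \<open>\<infinity>\<close> is at most
  \<^term>\<open>\<rho>\<close>.\<close>

definition min_total :: "real \<Rightarrow> real" where
  "min_total \<rho> = (1 - \<rho> * a) / (1 - a)"

lemma cost_slack_ge_1:
  assumes "1 \<le> x"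
  shows "(\<rho> * opt_cost x - x) / (1 - a) = \<rho> - min_total \<rho> * x"
proof -
  have "\<rho> * opt_cost x - x = \<rho> * (1 - a) - (1 - \<rho> * a) * x"
    using assms by (simp add: opt_cost_ge_1 algebra_simps)
  then show ?thesis
    using a_less_1 by (simp add: min_total_def diff_divide_distrib[of "\<rho> * (1 - a)"])
qed

text \<open>If the slack were \<^term>\<open>k - e\<close> with \<^term>\<open>e > 0\<close>, then half a time unit later it would be at most
  \<^term>\<open>k - 2 * e\<close>, because \<^term>\<open>F\<close> is below the slack and the slack has slope \<^term>\<open>F - k\<close>; so it
  would eventually be negative.\<close>

lemma min_total_le_slack:
  assumes F: "admissible \<rho> F" and x: "1 \<le> x"
  shows "min_total \<rho> \<le> cdf_integral F x + \<rho> - min_total \<rho> * x"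
proof (rule ccontr)
  define k where "k = min_total \<rho>"
  define H where "H y = cdf_integral F y + \<rho> - k * y" for y
  define e where "e = k - H x"
  assume "\<not> ?thesis"
  then have e: "0 < e" by (simp add: e_def H_def k_def)
  have F_le_H: "F y \<le> H y" if "1 \<le> y" for y
    using admissibleD(7)[OF F, of y] cost_slack_ge_1[OF that, of \<rho>] that by (simp add: H_def k_def)
  have step: "H (y + 1/2) \<le> k - 2 * d" if y: "1 \<le> y" and H: "H y \<le> k - d" for y d
  proof -
    have "cdf_integral F (y + 1/2) \<le> cdf_integral F y + F (y + 1/2) / 2"
      using cdf_integral_split[OF admissibleD(1)[OF F], of y "y + 1/2"]
        set_integral_Icc_bounds(2)[OF admissibleD(1)[OF F], of y "y + 1/2"] y by simp
    then have "H (y + 1/2) \<le> H y + (F (y + 1/2) - k) / 2"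
      by (simp add: H_def field_simps)
    then show ?thesis using F_le_H[of "y + 1/2"] y H by (simp add: field_simps)
  qed
  have H_le: "H (x + real n / 2) \<le> k - (real n + 1) * e" for n
  proof (induction n)
    case 0
    then show ?case by (simp add: e_def)
  next
    case (Suc n)
    have "H (x + real (Suc n) / 2) \<le> k - 2 * ((real n + 1) * e)"
      using step[OF _ Suc] x by (simp add: field_simps)
    also have "\<dots> \<le> k - (real (Suc n) + 1) * e"
      using e by (simp add: field_simps)
    finally show ?case .
  qed
  obtain n where n: "k / e < real n" using reals_Archimedean2 by blast
  have "0 \<le> H (x + real n / 2)"
    using F_le_H[of "x + real n / 2"] admissible_nonneg[OF F, of "x + real n / 2"] x by simp
  then show False
    using H_le[of n] n e by (simp add: field_simps)
qed

lemma admissible_truncate: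
  assumes F: "admissible \<rho> F" and \<rho>: "1 \<le> \<rho>"
  obtains G where "admissible \<rho> G" "\<And>x. L \<le> x \<Longrightarrow> G x = G L" "min_total \<rho> \<le> G L"
proof
  define k where "k = min_total \<rho>"
  \<comment> \<open>Below 1 nothing changes; from 1 on the values are raised to at least
    \<open>k\<close>, and from \<open>L\<close> on they are frozen.\<close>
  define G where "G x = (if x < 1 then F x else max (F (min x L)) k)" for x
  note mono = monoD[OF admissibleD(1)[OF F]]
  have "k \<le> 1"
    using \<rho> a_less_1 mult_right_mono[OF \<rho> a_nonneg] by (simp add: k_def min_total_def)
  show const: "G x = G L" if "L \<le> x" for x
    using that L_ge_1 by (simp add: G_def min_def)
  show ge_k: "min_total \<rho> \<le> G L"
    using L_ge_1 by (simp add: G_def k_def)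
  have F_le_G: "F x \<le> G x" if "x \<le> L" for x
    using that by (simp add: G_def)
  have mono_G: "mono G"
  proof (rule monoI)
    fix x y :: real assume "x \<le> y"
    then show "G x \<le> G y"
      using L_ge_1 mono[of x y] mono[of x "min y L"] mono[of "min x L" "min y L"]
      by (auto simp: G_def max_def min_def)
  qed
  have rc: "continuous (at_right x) G" for x
  proof -
    consider "x < 1" | "1 \<le> x" "x < L" | "1 \<le> x" "L \<le> x" by linarith
    then show ?thesis
    proof cases
      case 1
      then show ?thesis
        by (rule right_cont_cong[OF admissibleD(2)[OF F]]) (simp add: G_def)
    next
      case 2
      have "continuous (at_right x) (\<lambda>y. max (F y) k)"
        by (intro continuous_max admissibleD(2)[OF F] continuous_const)
      then show ?thesis
        by (rule right_cont_cong[OF _ 2(2)]) (use 2 in \<open>simp add: G_def\<close>)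
    next
      case 3
      show ?thesis
        by (rule right_cont_cong[of x "\<lambda>_. G L" "x + 1"]) (use 3 in \<open>auto intro: const\<close>)
    qed
  qed
  have tail: "G x \<le> \<delta> + G (bad_start x)" if x: "0 < x" for x
  proof (cases "x \<le> bad_start x")
    case True
    then show ?thesis using monoD[OF mono_G, of x "bad_start x"] delta_nonneg by simp
  next
    case False
    show ?thesis
    proof (cases "x < 1")
      case True
      then show ?thesis using admissibleD(5)[OF F x] False by (simp add: G_def)
    next
      case x1: False
      then have b: "1 \<le> bad_start x" by (simp add: bad_start_ge_1)
      \<comment> \<open>Both \<open>x\<close> and \<open>bad_start x\<close> lie in the raised
        range. Where \<open>G x\<close> is \<open>k\<close>, the right side is at least
        \<open>k\<close> too; where the right side is frozen at \<open>G L\<close>, so is the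
        largest possible left side.\<close>
      show ?thesis
        using x1 b delta_nonneg admissibleD(5)[OF F x] mono[of "min x L" x] mono[of "min x L" L]
        by (auto simp: G_def max_def min_def)
    qed
  qed
  have slack: "G x \<le> cdf_integral G x + \<rho> - k * x" if x: "1 \<le> x" "x \<le> L" for x
  proof -
    \<comment> \<open>\<open>G x\<close> is either \<open>F x\<close>, bounded by the ratio
      condition, or \<open>k\<close>, bounded by \<open>min_total_le_slack\<close>.\<close>
    have "G x \<le> cdf_integral F x + \<rho> - k * x"
      using admissibleD(7)[OF F, of x] cost_slack_ge_1[OF x(1), of \<rho>] min_total_le_slack[OF F x(1)] x
      by (simp add: G_def k_def)
    moreover have "cdf_integral F x \<le> cdf_integral G x"
      using x by (intro cdf_integral_mono admissibleD(1)[OF F] mono_G F_le_G) simp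
    ultimately show ?thesis by simp
  qed
  have "G x \<le> cdf_integral G x + (\<rho> * opt_cost x - x) / (1 - a)" if x: "0 < x" for x
  proof -
    consider "x < 1" | "1 \<le> x" "x \<le> L" | "1 \<le> x" "L < x" by linarith
    then show ?thesis
    proof cases
      case 1
      have "cdf_integral F x \<le> cdf_integral G x"
        using 1 L_ge_1 by (intro cdf_integral_mono admissibleD(1)[OF F] mono_G F_le_G) simp
      then show ?thesis using 1 admissibleD(7)[OF F x] by (simp add: G_def)
    next
      case 2
      then show ?thesis using slack[of x] cost_slack_ge_1[of x \<rho>] by (simp add: k_def)
    next
      case 3
      \<comment> \<open>Past \<open>L\<close> the integral grows at rate \<open>G L \<ge> k\<close>,
        so the slack does not fall below its value at \<open>L\<close>, while \<open>G\<close> stays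
        constant.\<close>
      have "cdf_integral G L + G L * (x - L) \<le> cdf_integral G x"
        using cdf_integral_split[OF mono_G, of L x] set_integral_Icc_bounds(1)[OF mono_G, of L x] 3 L_ge_1
        by simp
      moreover have "k * (x - L) \<le> G L * (x - L)"
        using ge_k 3 by (intro mult_right_mono) (auto simp: k_def)
      ultimately show ?thesis
        using slack[OF L_ge_1] cost_slack_ge_1[of x \<rho>] 3 const[of x] by (simp add: k_def algebra_simps)
    qed
  qed
  moreover have "1 - \<delta> \<le> G L"
    using admissibleD(6)[OF F] F_le_G[of L] by simp
  ultimately show "admissible \<rho> G"
    unfolding admissible_def
    using mono_G rc tail \<open>k \<le> 1\<close> admissibleD(3,4)[OF F] by (auto simp: G_def)
qed

section \<open>From admissible functions back to purchase distributions\<close>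

lemma feasible_of_admissible:
  assumes G: "admissible \<rho> G" and const: "\<And>x. L \<le> x \<Longrightarrow> G x = G L"
    and f: "purchase_distribution f" and cdf: "purchase_cdf f = G"
  shows "feasible a \<gamma> \<delta> f"
proof -
  interpret f: prob_space f using f by (simp add: purchase_distribution_def)
  have sets_f: "sets f = sets borel" using f by (simp add: purchase_distribution_def)
  have space_f: "space f = UNIV" using sets_eq_imp_space_eq[OF sets_f] by simp
  have [simp]: "bought_by s \<in> f.events" for s by (simp add: sets_f)
  have inter: "bought_by u \<inter> bought_by v = bought_by (min u v)" for u v
    by (auto simp: bought_by_def)
  have compl: "measure f (- bought_by s) = 1 - G s" for s
    using f.prob_compl[of "bought_by s"] by (simp add: cdf[symmetric] purchase_cdf_def space_f Compl_eq_Diff_UNIV)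
  have "measure f (bad_interval a \<gamma> x) \<le> \<delta>" if "0 < x" for x
  proof (cases x)
    case (real y)
    with that have y: "0 < y" by simp
    show ?thesis
    proof (cases "y \<le> L + 1")
      case True
      \<comment> \<open>The minimum with \<open>y\<close> makes the subtracted set a subset, also
        when \<open>bad_start y\<close> exceeds \<open>y\<close>.\<close>
      have "measure f (bought_by y - bought_by (bad_start y))
          = measure f (bought_by y - bought_by (min y (bad_start y)))"
        by (simp add: inter[symmetric] Diff_Int)
      also have "\<dots> = G y - G (min y (bad_start y))"
        by (subst f.finite_measure_Diff) (simp_all add: cdf[symmetric] purchase_cdf_def inter[symmetric] sets.Int)
      also have "\<dots> \<le> \<delta>"
        using admissibleD(5)[OF G y] delta_nonneg by (simp add: min_def)
      finally show ?thesis by (simp add: real bad_interval_upto[OF y True])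
    next
      case False
      then have "L \<le> bad_start y"
        using bad_start_mono[of "L + 1" y] by (simp add: bad_start_L)
      then have "G (min y (bad_start y)) = G L"
        using False by (intro const) simp
      then show ?thesis
        using False admissibleD(6)[OF G] by (simp add: real bad_interval_beyond inter compl)
    qed
  next
    case top
    have "bad_interval a \<gamma> x \<subseteq> - bought_by L"
      using gamma_gt_1 by (auto simp: top bad_interval_def ratio_def bought_by_def split: if_splits)
    then have "measure f (bad_interval a \<gamma> x) \<le> measure f (- bought_by L)"
      by (rule f.finite_measure_mono) (simp add: sets_f)
    then show ?thesis using compl[of L] admissibleD(6)[OF G] by simp
  qed
  with f show ?thesis by (simp add: feasible_def)
qed

lemma worst_ratio_of_admissible:
  assumes G: "admissible \<rho> G" and ge: "min_total \<rho> \<le> G L" and \<rho>: "1 \<le> \<rho>"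
    and f: "purchase_distribution f" and cdf: "purchase_cdf f = G"
  shows "worst_ratio a f \<le> ennreal \<rho>"
  unfolding worst_ratio_def
proof (rule SUP_least)
  interpret f: prob_space f using f by (simp add: purchase_distribution_def)
  have sets_f[measurable_cong]: "sets f = sets borel" using f by (simp add: purchase_distribution_def)
  have space_f: "space f = UNIV" using sets_eq_imp_space_eq[OF sets_f] by simp
  have [measurable]: "- bought_by L \<in> f.events" by (simp add: sets_f)
  have compl: "measure f (- bought_by L) = 1 - G L"
    using f.prob_compl[of "bought_by L"]
    by (simp add: cdf[symmetric] purchase_cdf_def space_f sets_f Compl_eq_Diff_UNIV)
  fix x :: ennreal assume "x \<in> {0<..}"
  show "expected_ratio a f x \<le> ennreal \<rho>"
  proof (cases x)
    case (real y)
    with \<open>x \<in> {0<..}\<close> have y: "0 < y" by simp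
    then show ?thesis
      using \<rho> admissibleD(7)[OF G y] by (simp add: real expected_ratio_le_iff[OF f] cdf)
  next
    case top
    show ?thesis
    proof (cases "a = 0")
      case True
      \<comment> \<open>For \<open>a = 0\<close> never buying has infinite ratio at \<infinity>, so
        it must have probability 0.\<close>
      then have "min_total \<rho> = 1" unfolding min_total_def by simp
      then have "measure f (- bought_by L) = 0"
        using ge compl measure_nonneg[of f "- bought_by L"] by linarith
      then have "- bought_by L \<in> null_sets f"
        by (simp add: null_sets_def f.emeasure_eq_measure)
      then have "AE t in f. ratio a t x = 1"
        by (rule AE_I') (auto simp: top ratio_def bought_by_def split: if_splits)
      then have "expected_ratio a f x = (\<integral>\<^sup>+ t. 1 \<partial>f)"
        unfolding expected_ratio_def by (rule nn_integral_cong_AE)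
      then show ?thesis using \<rho> by (simp add: f.emeasure_space_1)
    next
      case False
      with a_nonneg have a: "0 < a" by simp
      \<comment> \<open>The excess of the ratio of never buying over that of any finite purchase, at
        stopping time \<infinity>.\<close>
      define d where "d = 1 / a - 1"
      have d: "0 \<le> d" using a a_less_1 by (simp add: d_def)
      have "1 / ennreal a = ennreal (1 + d)"
        using a divide_ennreal[of 1 a] by (simp add: d_def)
      then have inv: "1 / ennreal a = 1 + ennreal d"
        using d by simp
      have "ratio a t x \<le> 1 + ennreal d * indicator (- bought_by L) t" for t
        by (cases "t = \<infinity>") (simp_all add: top ratio_def bought_by_def inv)
      then have "expected_ratio a f x \<le> (\<integral>\<^sup>+ t. 1 + ennreal d * indicator (- bought_by L) t \<partial>f)"
        unfolding expected_ratio_def by (rule nn_integral_mono)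
      also have "\<dots> = ennreal (1 + d * (1 - G L))"
        using d by (simp add: nn_integral_add nn_integral_cmult f.prob_space f.emeasure_eq_measure
            compl ennreal_mult admissibleD(4)[OF G])
      also have "\<dots> \<le> ennreal \<rho>"
      proof (rule ennreal_leI)
        have "d * (1 - G L) \<le> d * (1 - min_total \<rho>)"
          using d ge by (intro mult_left_mono) auto
        also have "\<dots> = \<rho> - 1"
          using a a_less_1 by (simp add: d_def min_total_def field_simps)
        finally show "1 + d * (1 - G L) \<le> \<rho>" by simp
      qed
      finally show ?thesis .
    qed
  qed
qed

section \<open>Finiteness and attainment of the optimal value\<close>

text \<open>Buying deterministically at the break-even time 1 has ratio at most
  \<open>2 - a \<le> \<gamma>\<close> at every stopping time, so no bad interval contains 1. This
  bounds \<open>OPT\<close> by a finite number.\<close>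

lemma feasible_return_1: "feasible a \<gamma> \<delta> (return borel 1)"
  and worst_ratio_return_1: "worst_ratio a (return borel 1) \<le> ennreal (2 - a)"
proof -
  have le: "ratio a 1 x \<le> ennreal (2 - a)" if "0 < x" for x
  proof (cases x)
    case (real y)
    with that have y: "0 < y" by simp
    have "real_ratio 1 y \<le> 2 - a"
    proof (cases "y < 1")
      case True
      then show ?thesis using y a_less_1 by (simp add: real_ratio_def bought_by_def opt_cost_le_1)
    next
      case False
      \<comment> \<open>This product is the difference of the two sides of the next
        inequality.\<close>
      have "0 \<le> a * (1 - a) * (y - 1)"
        using False a_nonneg a_less_1 by simp
      then have "y + (1 - a) * (2 - y) \<le> (2 - a) * opt_cost y"
        using False by (simp add: opt_cost_ge_1 algebra_simps)
      then show ?thesis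
        using False opt_cost_pos[OF y] by (simp add: real_ratio_def bought_by_def field_simps)
    qed
    then show ?thesis by (simp add: real ratio_eq[OF y] ennreal_leI)
  next
    case top
    then show ?thesis using a_less_1 by (simp add: ratio_def)
  qed
  have "bad_interval a \<gamma> x \<in> sets borel" for x
    unfolding bad_interval_def using ratio_measurable by measurable
  moreover have "1 \<notin> bad_interval a \<gamma> x" if "0 < x" for x
    using le[OF that] ennreal_leI[OF gamma_ge] by (auto simp: bad_interval_def not_less)
  ultimately show "feasible a \<gamma> \<delta> (return borel 1)"
    using delta_nonneg by (simp add: feasible_def purchase_distribution_def prob_space_return measure_return)
  show "worst_ratio a (return borel 1) \<le> ennreal (2 - a)"
    unfolding worst_ratio_def expected_ratio_def
    by (rule SUP_least) (use le in \<open>simp add: nn_integral_return ratio_measurable\<close>)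
qed

lemma worst_ratio_ge_1:
  assumes "purchase_distribution f"
  shows "1 \<le> worst_ratio a f"
proof -
  interpret f: prob_space f using assms by (simp add: purchase_distribution_def)
  have "1 \<le> ratio a t \<infinity>" for t
  proof (cases "a = 0")
    case False
    then have "1 / ennreal a = ennreal (1 / a)" "1 \<le> 1 / a"
      using a_nonneg a_less_1 by (simp_all add: divide_ennreal[symmetric])
    then show ?thesis by (auto simp: ratio_def simp flip: ennreal_1 intro: ennreal_leI)
  qed (simp add: ratio_def)
  then have "(\<integral>\<^sup>+ t. 1 \<partial>f) \<le> expected_ratio a f \<infinity>"
    unfolding expected_ratio_def by (intro nn_integral_mono) simp
  also have "\<dots> \<le> worst_ratio a f"
    unfolding worst_ratio_def by (rule SUP_upper) simp
  finally show ?thesis by (simp add: f.emeasure_space_1)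
qed

lemma OPT_eq_ennreal:
  obtains \<rho> where "OPT a \<gamma> \<delta> = ennreal \<rho>" "1 \<le> \<rho>"
proof -
  have "OPT a \<gamma> \<delta> \<le> worst_ratio a (return borel 1)"
    unfolding OPT_def by (rule INF_lower) (simp add: feasible_return_1)
  then have "OPT a \<gamma> \<delta> \<le> ennreal (2 - a)"
    using worst_ratio_return_1 by (rule order_trans)
  moreover have "1 \<le> OPT a \<gamma> \<delta>"
    unfolding OPT_def by (rule INF_greatest) (simp add: worst_ratio_ge_1 feasible_def)
  ultimately show ?thesis
    using that by (cases "OPT a \<gamma> \<delta>") (auto simp: top_unique)
qed

text \<open>Distribution functions of solutions within \<open>1 / (n + 1)\<close> of the optimum are
  admissible for these relaxed bounds, and \<open>admissible_limit\<close> removes the relaxation.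
  The limit becomes a measure only after truncation.\<close>

lemma OPT_admissible:
  assumes \<rho>: "OPT a \<gamma> \<delta> = ennreal \<rho>" "1 \<le> \<rho>"
  obtains F where "admissible \<rho> F"
proof -
  have "\<exists>F. admissible (\<rho> + inverse (real (Suc n))) F" for n
  proof -
    have "OPT a \<gamma> \<delta> < ennreal (\<rho> + inverse (real (Suc n)))"
      using \<rho> by (simp add: ennreal_less_iff del: of_nat_Suc)
    then obtain f where "feasible a \<gamma> \<delta> f" "worst_ratio a f < ennreal (\<rho> + inverse (real (Suc n)))"
      unfolding OPT_def by (auto simp: INF_less_iff)
    then show ?thesis
      using feasible_imp_admissible[of f "\<rho> + inverse (real (Suc n))"] \<rho>(2) by (auto intro: less_imp_le)
  qed
  then have "\<exists>F. \<forall>n. admissible (\<rho> + inverse (real (Suc n))) (F n)"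
    by (intro choice allI)
  then obtain F where F: "admissible (\<rho> + inverse (real (Suc n))) (F n)" for n by blast
  have "(\<lambda>n. \<rho> + inverse (real (Suc n))) \<longlonglongrightarrow> \<rho>"
    using tendsto_add[OF tendsto_const LIMSEQ_inverse_real_of_nat, of \<rho>] by simp
  from admissible_limit[OF F this] that show ?thesis .
qed

lemma optimal_upto_L:
  "\<exists>f. optimal a \<gamma> \<delta> f \<and> support f \<subseteq> {0..ennreal L} \<union> {\<infinity>} \<and> emeasure f {ennreal L<..<\<infinity>} = 0"
proof -
  obtain \<rho> where \<rho>: "OPT a \<gamma> \<delta> = ennreal \<rho>" "1 \<le> \<rho>" by (rule OPT_eq_ennreal)
  obtain F where F: "admissible \<rho> F" using OPT_admissible[OF \<rho>] .
  obtain G where G: "admissible \<rho> G" "\<And>x. L \<le> x \<Longrightarrow> G x = G L" "min_total \<rho> \<le> G L"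
    by (rule admissible_truncate[OF F \<rho>(2)]) (rule that)
  have "0 \<le> L" using L_ge_1 by simp
  note distribution_of_G = purchase_distribution_of_cdf[OF admissibleD(1-4)[OF G(1)] G(2) this]
  obtain f where f: "purchase_distribution f" "purchase_cdf f = G" "emeasure f {ennreal L<..<\<infinity>} = 0"
    by (rule distribution_of_G) (assumption | rule that)+
  have feas: "feasible a \<gamma> \<delta> f"
    using feasible_of_admissible[OF G(1,2) f(1,2)] .
  then have "OPT a \<gamma> \<delta> \<le> worst_ratio a f"
    unfolding OPT_def by (intro INF_lower) simp
  then have "optimal a \<gamma> \<delta> f"
    using feas worst_ratio_of_admissible[OF G(1,3) \<rho>(2) f(1,2)] \<rho>(1) by (simp add: optimal_def)
  moreover have "support f \<subseteq> {0..ennreal L} \<union> {\<infinity>}"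
  proof
    fix t assume "t \<in> support f"
    then have "t \<notin> {ennreal L<..<\<infinity>}"
      using f(3) unfolding support_def by (metis (mono_tags, lifting) mem_Collect_eq open_greaterThanLessThan less_irrefl)
    then show "t \<in> {0..ennreal L} \<union> {\<infinity>}" by (auto simp: not_less top_unique)
  qed
  ultimately show ?thesis using f(3) by blast
qed

end

theorem theorem5:
  fixes a \<gamma> \<delta> :: real
  assumes "0 \<le> a" and "a < 1"
    and "2 - a \<le> \<gamma>" and "ennreal \<gamma> < 1 / ennreal a"
    and "0 \<le> \<delta>" and "\<delta> \<le> 1"
  shows "\<exists>f. optimal a \<gamma> \<delta> f \<and>
             support f \<subseteq> {0..ennreal (L_b a \<gamma>)} \<union> {\<infinity>} \<and>
             emeasure f {ennreal (L_b a \<gamma>)<..<\<infinity>} = 0"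
proof -
  have "a * \<gamma> < 1"
  proof (cases "a = 0")
    case False
    then have "1 / ennreal a = ennreal (1 / a)"
      using \<open>0 \<le> a\<close> by (simp add: divide_ennreal[symmetric])
    then show ?thesis
      using assms False by (simp add: ennreal_less_iff field_simps)
  qed simp
  then interpret ski_rental a \<gamma> \<delta> using assms by unfold_locales
  show ?thesis by (rule optimal_upto_L)
qed

end
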